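(* Let $n\ge 1$ be an integer, and let $u=(u_1,\dots,u_n)$ with $u_k(t,x):=\Omega(t,x_k)$ for $k=1,\dots,n$, where $t\in\mathbb{R}$ and $x=(x_1,\dots,x_n)\in\mathbb{R}^n$. Then for every $k=1,\dots,n$, $$\frac{\partial u_k}{\partial t}+\sum_{i=1}^n u_i\,\frac{\partial u_k}{\partial x_i}=0\quad\text{on } \mathrm{int}\,\mathrm{Dom}(u).$$
   Context: $W$ denotes the principal real branch of the Lambert W function: for real $x\ge -1/e$, $w=W(x)$ if and only if $x=we^w$, $w\in\mathbb{R}$, $w\ge -1$. Its domain is $\mathrm{Dom}(W)=[-1/e,\infty)$. The function $\Omega$ of two real variables is defined by $$\Omega(x,y):=\frac{y}{x}-W\left(-\frac{1}{x}e^{y/x}\right),$$ on the set of all $(x,y)\in\mathbb{R}^2$ with $x<0$, or with $x>0$ and $y\le x\ln\frac{x}{e}$. The domain of $u$ is $\mathrm{Dom}(u):=\bigcap_{j=1}^n\mathrm{Dom}(u_j)$, where $$\mathrm{Dom}(u_j):=\left\{(t,x)\in\mathbb{R}^{n+1}:\ t<0\ \text{ or }\ \left(t>0\ \text{ and }\ x_j\le t\ln\frac{t}{e}\right)\right\},$$ with $x=(x_1,\dots,x_n)$. $\mathrm{int}$ denotes topological interior (here in $\mathbb{R}^{n+1}$). *)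

theory Defs
  imports "HOL-Analysis.Analysis"
begin

(* Principal real branch; the value is unspecified for x < - exp (- 1), outside its domain. *)
definition lambertW :: "real \<Rightarrow> real" where
  "lambertW x = (THE w. x = w * exp w \<and> w \<ge> - 1)"

(* Only meaningful for x < 0, or x > 0 and y \<le> x * ln (x / exp 1). *)
definition Omega :: "real \<Rightarrow> real \<Rightarrow> real" where
  "Omega x y = y / x - lambertW (- (1 / x) * exp (y / x))"

(* R^(n+1) is modelled as real \<times> (real ^ 'n), with n = CARD('n), which is at least 1. *)
definition u :: "'n::finite \<Rightarrow> real \<times> (real ^ 'n) \<Rightarrow> real" where
  "u k = (\<lambda>(t, x). Omega t (x $ k))"

definition Dom_u_comp :: "'n::finite \<Rightarrow> (real \<times> (real ^ 'n)) set" where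
  "Dom_u_comp j = {(t, x). t < 0 \<or> (t > 0 \<and> x $ j \<le> t * ln (t / exp 1))}"

definition Dom_u :: "(real \<times> (real ^ 'n::finite)) set" where
  "Dom_u = (\<Inter>j. Dom_u_comp j)"

(* Restriction of f to the line through p in the direction of the i-th space coordinate,
   parametrised by the value s of that coordinate. *)
definition space_line ::
    "(real \<times> (real ^ 'n::finite) \<Rightarrow> real) \<Rightarrow> 'n \<Rightarrow> real \<times> (real ^ 'n) \<Rightarrow> real \<Rightarrow> real" where
  "space_line f i p = (\<lambda>s. f (fst p, \<chi> j. if j = i then s else snd p $ j))"

definition time_line ::
    "(real \<times> (real ^ 'n::finite) \<Rightarrow> real) \<Rightarrow> real \<times> (real ^ 'n) \<Rightarrow> real \<Rightarrow> real" where
  "time_line f p = (\<lambda>s. f (s, snd p))"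

(* The library constant deriv is total, so existence of the partial derivatives is a
   separate predicate. *)
definition has_partials :: "(real \<times> (real ^ 'n::finite) \<Rightarrow> real) \<Rightarrow> real \<times> (real ^ 'n) \<Rightarrow> bool" where
  "has_partials f p \<longleftrightarrow>
     time_line f p differentiable (at (fst p)) \<and>
     (\<forall>i. space_line f i p differentiable (at (snd p $ i)))"

definition partial_t :: "(real \<times> (real ^ 'n::finite) \<Rightarrow> real) \<Rightarrow> real \<times> (real ^ 'n) \<Rightarrow> real" where
  "partial_t f p = deriv (time_line f p) (fst p)"

definition partial_x :: "'n::finite \<Rightarrow> (real \<times> (real ^ 'n) \<Rightarrow> real) \<Rightarrow> real \<times> (real ^ 'n) \<Rightarrow> real" where
  "partial_x i f p = deriv (space_line f i p) (snd p $ i)"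

end

theory Submission
  imports Defs
begin

(* On the interior of the domain W is evaluated at z = - exp (x/t) / t > - 1/e, where it is smooth
   with z W'(z) = W(z) / (1 + W(z)). Hence \<partial>\<Omega>/\<partial>x = 1 / (t (1 + W(z))) and, by the chain rule,
   \<partial>\<Omega>/\<partial>t = (W(z) - x/t) / (t (1 + W(z))) = - \<Omega> \<partial>\<Omega>/\<partial>x. Since u_k depends on x_k and t only,
   just the summand i = k survives. *)

text \<open>The derivative \<open>(1 + x) * exp x\<close> is positive for \<open>x > - 1\<close>.
  Positivity on the open interval suffices, so the endpoint \<open>v = - 1\<close> is
  allowed.\<close>

lemma mult_exp_strict_mono:
  fixes v w :: real
  assumes "- 1 \<le> v" "v < w"
  shows "v * exp v < w * exp w"
proof (rule DERIV_pos_imp_increasing_open[OF assms(2)])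
  fix x assume "v < x" "x < w"
  have "((\<lambda>x. x * exp x) has_real_derivative (1 + x) * exp x) (at x)"
    by (auto intro!: derivative_eq_intros simp: algebra_simps)
  then show "\<exists>y. ((\<lambda>x. x * exp x) has_real_derivative y) (at x) \<and> y > 0"
    using \<open>v < x\<close> assms(1) by (intro exI[of _ "(1 + x) * exp x"]) auto
qed (intro continuous_intros)

lemma lambertW_mult_exp:
  assumes "- 1 \<le> w"
  shows "lambertW (w * exp w) = w"
  unfolding lambertW_def
proof (rule the_equality)
  fix v :: real assume "w * exp w = v * exp v \<and> - 1 \<le> v"
  then show "v = w"
    using mult_exp_strict_mono[of v w] mult_exp_strict_mono[of w v] assms
    by (cases v w rule: linorder_cases) auto
qed (use assms in auto)

text \<open>Intermediate value theorem starting from \<open>- 1\<close>. The strict hypothesis rules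
  out \<open>w = - 1\<close>, the only point where the derivative of \<open>w * exp w\<close>
  vanishes on the branch.\<close>

lemma mult_exp_surj:
  fixes z :: real
  assumes "- exp (- 1) < z"
  obtains w where "- 1 < w" "z = w * exp w"
proof -
  \<comment> \<open>An upper endpoint with \<open>b \<ge> z\<close> and \<open>b \<ge> 0\<close>, so
    that \<open>z \<le> b \<le> b * exp b\<close>.\<close>
  define b where "b = max 1 z"
  have "b * 1 \<le> b * exp b"
    by (intro mult_left_mono) (auto simp: b_def)
  then have "z \<le> b * exp b" by (auto simp: b_def)
  then have "\<exists>w\<ge>- 1. w \<le> b \<and> w * exp w = z"
    using assms by (intro IVT' continuous_intros) (auto simp: b_def)
  then obtain w where "w \<ge> - 1" "w * exp w = z" by blast
  moreover from this have "w \<noteq> - 1" using assms by auto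
  ultimately show thesis using that[of w] by auto
qed

lemma lambertW_has_real_derivative:
  assumes "- 1 < w"
  shows "(lambertW has_real_derivative 1 / ((1 + w) * exp w)) (at (w * exp w))"
proof -
  let ?f = "\<lambda>x::real. x * exp x"
  have inv: "?f (lambertW y) = y" if y: "- exp (- 1) < y" for y
  proof -
    obtain v where "- 1 < v" "y = v * exp v" by (rule mult_exp_surj[OF y])
    then show ?thesis by (simp add: lambertW_mult_exp)
  qed
  have z: "- exp (- 1) < ?f w"
    using mult_exp_strict_mono[of "- 1" w] assms by simp
  \<comment> \<open>The inverse function rule needs continuity of the inverse; it holds because
    \<open>lambertW\<close> inverts a continuous map on an interval around \<open>w\<close>.\<close>
  have "isCont lambertW (?f w)"
  proof (rule isCont_inverse_function2[of "- 1" w "w + 1"])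
    show "lambertW (v * exp v) = v" if "- 1 \<le> v" for v
      using that by (rule lambertW_mult_exp)
  qed (use assms in auto)
  moreover have "(?f has_real_derivative (1 + w) * exp w) (at (lambertW (?f w)))"
    using lambertW_mult_exp[of w] assms
    by (auto intro!: derivative_eq_intros simp: algebra_simps)
  ultimately have "(lambertW has_real_derivative inverse ((1 + w) * exp w)) (at (?f w))"
    using assms z inv
    by (intro DERIV_inverse_function[where f = ?f and a = "- exp (- 1)" and b = "?f w + 1"]) auto
  then show ?thesis by (simp add: inverse_eq_divide)
qed

text \<open>The case of one space variable: a single \<open>D\<close> expresses both partial
  derivatives, so the equation can be read off.\<close>

lemma Omega_partials:
  fixes t x :: real
  assumes "t < 0 \<or> t > 0 \<and> x < t * ln (t / exp 1)"
  obtains D where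
    "((\<lambda>y. Omega t y) has_real_derivative D) (at x)"
    "((\<lambda>s. Omega s x) has_real_derivative - (Omega t x * D)) (at t)"
proof -
  define z where "z = - (1 / t) * exp (x / t)"
  have t0: "t \<noteq> 0" using assms by auto
  \<comment> \<open>For \<open>t < 0\<close> the value \<open>z\<close> is positive; for
    \<open>t > 0\<close> the bound is the exponentiated form of the strict inequality assumed on
    \<open>x\<close>.\<close>
  have "- exp (- 1) < z"
  proof (cases "t < 0")
    case True
    then have "z > 0" by (auto simp: z_def divide_pos_neg)
    moreover have "- exp (- 1) < (0::real)" by simp
    ultimately show ?thesis by linarith
  next
    case False
    then have t: "t > 0" "x / t < ln (t / exp 1)" using assms by (auto simp: field_simps)
    then have "exp (x / t) < exp (ln (t / exp 1))" by (simp only: exp_less_cancel_iff)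
    also have "\<dots> = t * exp (- 1)" using t by (simp add: exp_minus divide_inverse)
    finally have "exp (x / t) < t * exp (- 1)" .
    then show ?thesis using t by (simp add: z_def field_simps)
  qed
  then obtain w where w: "- 1 < w" "z = w * exp w" by (rule mult_exp_surj)
  have Om: "Omega t x = x / t - w"
    using w lambertW_mult_exp[of w] by (simp add: Omega_def z_def)
  \<comment> \<open>The point is written out instead of \<open>z\<close> to match the inner function
    in both uses of \<open>DERIV_chain2\<close>.\<close>
  have W: "(lambertW has_real_derivative 1 / ((1 + w) * exp w)) (at (- (1 / t) * exp (x / t)))"
    using lambertW_has_real_derivative[OF w(1)] w(2) by (simp add: z_def)
  have zW: "z / ((1 + w) * exp w) = w / (1 + w)"
    using w by simp
  have zx: "((\<lambda>y. - (1 / t) * exp (y / t)) has_real_derivative z / t) (at x)"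
    using t0 by (auto intro!: derivative_eq_intros simp: z_def)
  have zt: "((\<lambda>s. - (1 / s) * exp (x / s)) has_real_derivative - (z * (1 + x / t) / t)) (at t)"
    using t0 by (auto intro!: derivative_eq_intros simp: z_def field_simps power2_eq_square)
  have "((\<lambda>y. Omega t y) has_real_derivative 1 / t - 1 / ((1 + w) * exp w) * (z / t)) (at x)"
    unfolding Omega_def
    by (intro DERIV_diff DERIV_chain2[OF W zx]) (use t0 in \<open>auto intro!: derivative_eq_intros\<close>)
  also have "1 / t - 1 / ((1 + w) * exp w) * (z / t) = (1 - z / ((1 + w) * exp w)) / t"
    by (simp add: diff_divide_distrib)
  also have "\<dots> = 1 / (t * (1 + w))"
    unfolding zW using w t0 by (simp add: field_simps)
  finally have 1: "((\<lambda>y. Omega t y) has_real_derivative 1 / (t * (1 + w))) (at x)" .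
  have "((\<lambda>s. Omega s x) has_real_derivative
      - (x / t\<^sup>2) - 1 / ((1 + w) * exp w) * - (z * (1 + x / t) / t)) (at t)"
    unfolding Omega_def
    by (intro DERIV_diff DERIV_chain2[OF W zt])
       (use t0 in \<open>auto intro!: derivative_eq_intros simp: power2_eq_square\<close>)
  also have "- (x / t\<^sup>2) - 1 / ((1 + w) * exp w) * - (z * (1 + x / t) / t) =
      - (x / t\<^sup>2) + z / ((1 + w) * exp w) * ((1 + x / t) / t)"
    by simp
  \<comment> \<open>Over the denominator \<open>t * (1 + w)\<close> the terms
    \<open>w * x / t\<close> cancel, leaving the numerator \<open>w - x / t\<close>.\<close>
  also have "\<dots> = - (Omega t x * (1 / (t * (1 + w))))"
    unfolding zW Om using w t0 by (simp add: divide_simps) (simp add: algebra_simps power2_eq_square)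
  finally have 2: "((\<lambda>s. Omega s x) has_real_derivative - (Omega t x * (1 / (t * (1 + w))))) (at t)" .
  from that[OF 1 2] show thesis .
qed

text \<open>A point of the interior can be moved by some \<open>e > 0\<close> in direction
  \<open>k\<close> without leaving the domain; the weak bound at the moved point is strict at
  \<open>p\<close>.\<close>

lemma interior_Dom_u_strict:
  fixes p :: "real \<times> (real ^ 'n::finite)"
  assumes "p \<in> interior Dom_u"
  shows "fst p < 0 \<or> fst p > 0 \<and> snd p $ k < fst p * ln (fst p / exp 1)"
proof -
  obtain e where e: "e > 0" "cball p e \<subseteq> Dom_u"
    using assms by (auto simp: mem_interior_cball)
  define q where "q = (fst p, snd p + e *\<^sub>R axis k 1)"
  have "dist p q = e"
    using e by (simp add: q_def dist_prod_def dist_norm)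
  then have "q \<in> Dom_u_comp k" using e by (auto simp: Dom_u_def)
  then show ?thesis using e(1) by (auto simp: q_def Dom_u_comp_def)
qed

theorem theorem1:
  fixes k :: "'n::finite"
  shows "\<forall>p \<in> interior (Dom_u :: (real \<times> (real ^ 'n)) set).
           has_partials (u k) p \<and>
           partial_t (u k) p + (\<Sum>i\<in>UNIV. u i p * partial_x i (u k) p) = 0"
proof
  fix p :: "real \<times> (real ^ 'n)"
  assume "p \<in> interior Dom_u"
  then obtain D where
    D: "((\<lambda>y. Omega (fst p) y) has_real_derivative D) (at (snd p $ k))"
       "((\<lambda>s. Omega s (snd p $ k)) has_real_derivative - (Omega (fst p) (snd p $ k) * D)) (at (fst p))"
    using Omega_partials[OF interior_Dom_u_strict] by blast
  have u: "u k p = Omega (fst p) (snd p $ k)"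
    by (simp add: u_def case_prod_beta)
  have time: "(time_line (u k) p has_real_derivative - (u k p * D)) (at (fst p))"
    using D(2) by (simp add: time_line_def u_def case_prod_beta)
  \<comment> \<open>For \<open>i \<noteq> k\<close> the restricted function is constant.\<close>
  have space: "(space_line (u k) i p has_real_derivative (if i = k then D else 0)) (at (snd p $ i))" for i
    using D(1) by (auto simp: space_line_def u_def)
  have "has_partials (u k) p"
    unfolding has_partials_def real_differentiable_def using time space by blast
  moreover have "partial_t (u k) p = - (u k p * D)"
    unfolding partial_t_def using time by (rule DERIV_imp_deriv)
  moreover have "partial_x i (u k) p = (if i = k then D else 0)" for i
    unfolding partial_x_def using space by (rule DERIV_imp_deriv)
  ultimately show "has_partials (u k) p \<and>
      partial_t (u k) p + (\<Sum>i\<in>UNIV. u i p * partial_x i (u k) p) = 0"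
    by (simp add: mult_delta_right)
qed

end
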